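(* Let $X$ be a Hausdorff topological space. Then $X$ is topologically well-orderable if and only if $\mathcal{F}_2(X)$ has a $\tau_F$-continuous selection.
   Context: For a topological space $X$, $\mathcal{F}(X)$ denotes the family of all non-empty closed subsets of $X$, and $\mathcal{F}_2(X)=\{S\in\mathcal{F}(X): |S|\le 2\}$. For a finite family $\mathcal{V}$ of open subsets of $X$, put $\langle\mathcal{V}\rangle=\{S\in\mathcal{F}(X): S\cap V\neq\emptyset \text{ for every } V\in\mathcal{V}, \text{ and } S\subset\bigcup\mathcal{V}\}$. The Fell topology $\tau_F$ on $\mathcal{F}(X)$ is the topology with base consisting of all sets $\langle\mathcal{V}\rangle$, where $\mathcal{V}$ is a finite family of open subsets of $X$ such that $X\setminus\bigcup\mathcal{V}$ is compact. For $\mathcal{D}\subset\mathcal{F}(X)$ and a topology $\tau$ on $\mathcal{F}(X)$, a selection for $\mathcal{D}$ is a map $f:\mathcal{D}\to X$ such that $f(S)\in S$ for every $S\in\mathcal{D}$; it is $\tau$-continuous if it is continuous with respect to the relative topology on $\mathcal{D}$ as a subspace of $(\mathcal{F}(X),\tau)$. A space $X$ is topologically well-orderable if there exists a linear order $\prec$ on $X$ such that $X$ is a linearly ordered topological space with respect to $\prec$ (i.e. the topology of $X$ is the order topology of $\prec$), and every non-empty closed subset of $X$ has a $\prec$-minimal element. *)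

theory Defs
  imports "HOL-Analysis.Analysis"
begin

definition closed_hyperspace :: "'a topology \<Rightarrow> 'a set set" where
  "closed_hyperspace X = {S. closedin X S \<and> S \<noteq> {}}"

(* The conjunct finite S is needed because card is 0 on infinite sets. *)
definition closed_hyperspace2 :: "'a topology \<Rightarrow> 'a set set" where
  "closed_hyperspace2 X = {S \<in> closed_hyperspace X. finite S \<and> card S \<le> 2}"

definition hit_miss :: "'a topology \<Rightarrow> 'a set set \<Rightarrow> 'a set set" where
  "hit_miss X \<V> = {S \<in> closed_hyperspace X. (\<forall>V\<in>\<V>. S \<inter> V \<noteq> {}) \<and> S \<subseteq> \<Union>\<V>}"

definition fell_base :: "'a topology \<Rightarrow> 'a set set set" where
  "fell_base X = {hit_miss X \<V> | \<V>.
     finite \<V> \<and> (\<forall>V\<in>\<V>. openin X V) \<and> compactin X (topspace X - \<Union>\<V>)}"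

definition fell_topology :: "'a topology \<Rightarrow> 'a set topology" where
  "fell_topology X = topology (arbitrary union_of (\<lambda>B. B \<in> fell_base X))"

definition selection_on :: "'a set set \<Rightarrow> ('a set \<Rightarrow> 'a) \<Rightarrow> bool" where
  "selection_on D f \<longleftrightarrow> (\<forall>S\<in>D. f S \<in> S)"

definition continuous_selection ::
    "'a topology \<Rightarrow> 'a set topology \<Rightarrow> 'a set set \<Rightarrow> ('a set \<Rightarrow> 'a) \<Rightarrow> bool" where
  "continuous_selection X T D f \<longleftrightarrow>
     selection_on D f \<and> continuous_map (subtopology T D) X f"

(* The relation r is the strict order. The set A is put into the subbase because a
   one-point order has no open rays that cover it. *)
definition order_topology_on :: "'a set \<Rightarrow> 'a rel \<Rightarrow> 'a topology" where
  "order_topology_on A r = topology_generated_by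
     (insert A ((\<lambda>a. {x \<in> A. (x, a) \<in> r}) ` A \<union> (\<lambda>a. {x \<in> A. (a, x) \<in> r}) ` A))"

definition topologically_well_orderable :: "'a topology \<Rightarrow> bool" where
  "topologically_well_orderable X \<longleftrightarrow>
     (\<exists>r. r \<subseteq> topspace X \<times> topspace X \<and> strict_linear_order_on (topspace X) r \<and>
          X = order_topology_on (topspace X) r \<and>
          (\<forall>S. closedin X S \<and> S \<noteq> {} \<longrightarrow> (\<exists>m\<in>S. \<forall>x\<in>S. (x, m) \<notin> r)))"

(* The constant topology yields the intended open sets only if its argument
   satisfies istopology; the next lemmas show that fell_base is indeed a base. *)
lemma fell_base_Int:
  assumes "B \<in> fell_base X" "C \<in> fell_base X"
  shows "B \<inter> C \<in> fell_base X"
proof -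
  obtain \<V> where V: "B = hit_miss X \<V>" "finite \<V>" "\<forall>V\<in>\<V>. openin X V"
      "compactin X (topspace X - \<Union>\<V>)"
    using assms(1) unfolding fell_base_def by blast
  obtain \<W> where W: "C = hit_miss X \<W>" "finite \<W>" "\<forall>V\<in>\<W>. openin X V"
      "compactin X (topspace X - \<Union>\<W>)"
    using assms(2) unfolding fell_base_def by blast
  define \<U> where "\<U> = (\<lambda>V. V \<inter> \<Union>\<W>) ` \<V> \<union> (\<lambda>W. W \<inter> \<Union>\<V>) ` \<W>"
  have Un: "\<Union>\<U> = \<Union>\<V> \<inter> \<Union>\<W>"
    unfolding \<U>_def by blast
  have "openin X (\<Union>\<V>)" "openin X (\<Union>\<W>)"
    using V(3) W(3) by (auto intro: openin_Union)
  then have op: "\<forall>U\<in>\<U>. openin X U"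
    using V(3) W(3) unfolding \<U>_def by (auto intro: openin_Int)
  have "topspace X - \<Union>\<U> = (topspace X - \<Union>\<V>) \<union> (topspace X - \<Union>\<W>)"
    unfolding Un by blast
  then have cpt: "compactin X (topspace X - \<Union>\<U>)"
    using compactin_Un[OF V(4) W(4)] by simp
  have hit: "(\<forall>U\<in>\<U>. S \<inter> U \<noteq> {}) \<longleftrightarrow> (\<forall>V\<in>\<V>. S \<inter> V \<noteq> {}) \<and> (\<forall>W\<in>\<W>. S \<inter> W \<noteq> {})"
    if "S \<subseteq> \<Union>\<V> \<inter> \<Union>\<W>" for S
  proof -
    have "S \<inter> (V \<inter> \<Union>\<W>) = S \<inter> V" "S \<inter> (V \<inter> \<Union>\<V>) = S \<inter> V" for V
      using that by blast+
    then show ?thesis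
      unfolding \<U>_def ball_Un ball_simps by (simp only:)
  qed
  have "B \<inter> C = hit_miss X \<U>"
    unfolding V(1) W(1)
  proof (rule set_eqI)
    fix S
    show "S \<in> hit_miss X \<V> \<inter> hit_miss X \<W> \<longleftrightarrow> S \<in> hit_miss X \<U>"
    proof (cases "S \<subseteq> \<Union>\<V> \<inter> \<Union>\<W>")
      case True
      then have "S \<subseteq> \<Union>\<V>" "S \<subseteq> \<Union>\<W>"
        by (simp_all only: Int_subset_iff)
      then show ?thesis
        unfolding hit_miss_def Un Int_iff mem_Collect_eq hit[OF True] Int_subset_iff by argo
    next
      case False
      then show ?thesis
        unfolding hit_miss_def Un Int_iff mem_Collect_eq Int_subset_iff by argo
    qed
  qed
  moreover have "finite \<U>"
    unfolding \<U>_def using V(2) W(2) by simp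
  ultimately show ?thesis
    unfolding fell_base_def using op cpt by blast
qed

lemma openin_fell_topology:
  "openin (fell_topology X) = arbitrary union_of (\<lambda>B. B \<in> fell_base X)"
  unfolding fell_topology_def
  by (intro topology_inverse' istopology_base fell_base_Int)

lemma topspace_fell_topology: "topspace (fell_topology X) = closed_hyperspace X"
proof
  show "topspace (fell_topology X) \<subseteq> closed_hyperspace X"
  proof
    fix S assume "S \<in> topspace (fell_topology X)"
    then obtain U where "openin (fell_topology X) U" "S \<in> U"
      unfolding topspace_def by blast
    then obtain B where "B \<in> fell_base X" "S \<in> B"
      unfolding openin_fell_topology union_of_def by blast
    then show "S \<in> closed_hyperspace X"
      unfolding fell_base_def hit_miss_def by blast
  qed
  have eq: "hit_miss X {topspace X} = closed_hyperspace X"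
    unfolding hit_miss_def closed_hyperspace_def by (auto dest: closedin_subset)
  have "hit_miss X {topspace X} \<in> fell_base X"
    unfolding fell_base_def by (intro CollectI exI[of _ "{topspace X}"]) simp
  then have "openin (fell_topology X) (closed_hyperspace X)"
    unfolding openin_fell_topology eq by (rule arbitrary_union_of_inc)
  then show "closed_hyperspace X \<subseteq> topspace (fell_topology X)"
    by (rule openin_subset)
qed

lemma topspace_order_topology_on: "topspace (order_topology_on A r) = A"
  unfolding order_topology_on_def topology_generated_by_topspace by auto

end

theory Submission
  imports Defs
begin

text \<open>If \<open>X\<close> is topologically well-orderable, then every initial segment is compact, and hence the
  minimum is a Fell-continuous selection.

  Conversely, a continuous selection \<open>f\<close> for pairs gives a closed, total, antisymmetric, but
  possibly intransitive relation: \<open>x\<close> is below \<open>y\<close> iff \<open>f {x, y} = x\<close>. Fell continuity at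
  the singletons makes the set of points below a given point compact. To obtain a transitive order,
  well-order \<open>X\<close> arbitrarily and insert its points in this order into a binary search tree that
  compares with the given relation. The nodes at which a search path turns left form a decreasing
  chain and those at which it turns right an increasing one; by compactness such a chain has only
  one limit, and this forces the open rays of the in-order of the tree to be open in \<open>X\<close>. Since
  moreover the initial segments of this order are compact, its order topology is the topology of
  \<open>X\<close>, and every non-empty closed set has a minimum.\<close>

section \<open>Order topologies and the minimum selection\<close>

definition initial_segment :: "'a set \<Rightarrow> 'a rel \<Rightarrow> 'a \<Rightarrow> 'a set" where
  "initial_segment A r x = {y \<in> A. y = x \<or> (y, x) \<in> r}"

lemma openin_order_topology_on_lessThan:
  "a \<in> A \<Longrightarrow> openin (order_topology_on A r) {x \<in> A. (x, a) \<in> r}"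
  unfolding order_topology_on_def by (rule topology_generated_by_Basis) blast

lemma openin_order_topology_on_greaterThan:
  "a \<in> A \<Longrightarrow> openin (order_topology_on A r) {x \<in> A. (a, x) \<in> r}"
  unfolding order_topology_on_def by (rule topology_generated_by_Basis) blast

text \<open>Two points with a point \<open>z\<close> between them are separated by the two rays at
  \<open>z\<close>. Without such a point, the ray below the larger and the ray above the smaller are
  already disjoint.\<close>

lemma Hausdorff_space_order_topology_on:
  assumes "strict_linear_order_on A r"
  shows "Hausdorff_space (order_topology_on A r)"
proof -
  have tr: "\<And>x y z. (x, y) \<in> r \<Longrightarrow> (y, z) \<in> r \<Longrightarrow> (x, z) \<in> r" and ir: "\<And>x. (x, x) \<notin> r"
    and tot: "\<And>x y. x \<in> A \<Longrightarrow> y \<in> A \<Longrightarrow> x \<noteq> y \<Longrightarrow> (x, y) \<in> r \<or> (y, x) \<in> r"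
    using assms unfolding strict_linear_order_on_def trans_def irrefl_def total_on_def by blast+
  have sep: "\<exists>U V. openin (order_topology_on A r) U \<and> openin (order_topology_on A r) V \<and>
      x \<in> U \<and> y \<in> V \<and> disjnt U V" if "x \<in> A" "y \<in> A" "(x, y) \<in> r" for x y
  proof (cases "\<exists>z\<in>A. (x, z) \<in> r \<and> (z, y) \<in> r")
    case True
    then obtain z where z: "z \<in> A" "(x, z) \<in> r" "(z, y) \<in> r" by blast
    show ?thesis
      using z that tr ir unfolding disjnt_iff
      by (intro exI[of _ "{x \<in> A. (x, z) \<in> r}"] exI[of _ "{x \<in> A. (z, x) \<in> r}"])
        (auto simp: openin_order_topology_on_lessThan openin_order_topology_on_greaterThan)
  next
    case False
    then show ?thesis
      using that unfolding disjnt_iff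
      by (intro exI[of _ "{z \<in> A. (z, y) \<in> r}"] exI[of _ "{z \<in> A. (x, z) \<in> r}"])
        (auto simp: openin_order_topology_on_lessThan openin_order_topology_on_greaterThan)
  qed
  show ?thesis
    unfolding Hausdorff_space_def topspace_order_topology_on
  proof (intro allI impI)
    fix x y assume xy: "x \<in> A \<and> y \<in> A \<and> x \<noteq> y"
    then consider "(x, y) \<in> r" | "(y, x) \<in> r" using tot by blast
    then show "\<exists>U V. openin (order_topology_on A r) U \<and> openin (order_topology_on A r) V \<and>
      x \<in> U \<and> y \<in> V \<and> disjnt U V"
    proof cases
      case 1 then show ?thesis using sep xy by blast
    next
      case 2 then show ?thesis using sep[of y x] xy by (meson disjnt_sym)
    qed
  qed
qed

text \<open>Rays in one direction form a chain, so a finite intersection of subbasic sets reduces to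
  one upper and one lower ray; \<open>A\<close> stands for a missing bound.\<close>

lemma order_topology_on_interval_nbhd:
  assumes lin: "strict_linear_order_on A r"
    and U: "openin (order_topology_on A r) U" and x: "x \<in> U"
  obtains L R where "L \<in> insert A ((\<lambda>a. {x \<in> A. (a, x) \<in> r}) ` A)"
    "R \<in> insert A ((\<lambda>a. {x \<in> A. (x, a) \<in> r}) ` A)" "x \<in> L \<inter> R" "L \<inter> R \<subseteq> U"
proof -
  let ?\<L> = "insert A ((\<lambda>a. {x \<in> A. (a, x) \<in> r}) ` A)"
  let ?\<R> = "insert A ((\<lambda>a. {x \<in> A. (x, a) \<in> r}) ` A)"
  have tr: "\<And>x y z. (x, y) \<in> r \<Longrightarrow> (y, z) \<in> r \<Longrightarrow> (x, z) \<in> r"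
    and tot: "\<And>x y. x \<in> A \<Longrightarrow> y \<in> A \<Longrightarrow> x \<noteq> y \<Longrightarrow> (x, y) \<in> r \<or> (y, x) \<in> r"
    using lin unfolding strict_linear_order_on_def trans_def total_on_def by blast+
  have chainL: "L \<inter> L' \<in> ?\<L>" if L: "L \<in> ?\<L>" and L': "L' \<in> ?\<L>" for L L'
  proof -
    have "L \<subseteq> L' \<or> L' \<subseteq> L"
    proof (cases "L = A \<or> L' = A")
      case True
      then show ?thesis using L L' by auto
    next
      case False
      then obtain a b where ab: "a \<in> A" "b \<in> A" "L = {x \<in> A. (a, x) \<in> r}" "L' = {x \<in> A. (b, x) \<in> r}"
        using L L' by auto
      consider "a = b" | "(a, b) \<in> r" | "(b, a) \<in> r" using tot ab(1,2) by blast
      then show ?thesis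
        by cases (use ab(3,4) tr in auto)
    qed
    then have "L \<inter> L' = L \<or> L \<inter> L' = L'" by blast
    then show ?thesis using L L' by (elim disjE) (simp_all only:)
  qed
  have chainR: "L \<inter> L' \<in> ?\<R>" if L: "L \<in> ?\<R>" and L': "L' \<in> ?\<R>" for L L'
  proof -
    have "L \<subseteq> L' \<or> L' \<subseteq> L"
    proof (cases "L = A \<or> L' = A")
      case True
      then show ?thesis using L L' by auto
    next
      case False
      then obtain a b where ab: "a \<in> A" "b \<in> A" "L = {x \<in> A. (x, a) \<in> r}" "L' = {x \<in> A. (x, b) \<in> r}"
        using L L' by auto
      consider "a = b" | "(a, b) \<in> r" | "(b, a) \<in> r" using tot ab(1,2) by blast
      then show ?thesis
        by cases (use ab(3,4) tr in auto)
    qed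
    then have "L \<inter> L' = L \<or> L \<inter> L' = L'" by blast
    then show ?thesis using L L' by (elim disjE) (simp_all only:)
  qed
  have "generate_topology_on (insert A ((\<lambda>a. {x \<in> A. (x, a) \<in> r}) ` A \<union> (\<lambda>a. {x \<in> A. (a, x) \<in> r}) ` A)) U"
    using U unfolding order_topology_on_def openin_topology_generated_by_iff .
  then have "\<forall>x\<in>U. \<exists>L\<in>?\<L>. \<exists>R\<in>?\<R>. x \<in> L \<inter> R \<and> L \<inter> R \<subseteq> U"
  proof induction
    case (Int a b)
    show ?case
    proof
      fix x assume "x \<in> a \<inter> b"
      then obtain L R L' R' where LR: "L \<in> ?\<L>" "R \<in> ?\<R>" "L' \<in> ?\<L>" "R' \<in> ?\<R>"
        "x \<in> L \<inter> R" "L \<inter> R \<subseteq> a" "x \<in> L' \<inter> R'" "L' \<inter> R' \<subseteq> b"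
        using Int.IH by (meson IntD1 IntD2)
      show "\<exists>L\<in>?\<L>. \<exists>R\<in>?\<R>. x \<in> L \<inter> R \<and> L \<inter> R \<subseteq> a \<inter> b"
        by (rule bexI[OF _ chainL[OF LR(1,3)]], rule bexI[OF _ chainR[OF LR(2,4)]])
          (use LR(5-8) in blast)
    qed
  next
    case (UN K)
    show ?case
    proof
      fix x assume "x \<in> \<Union>K"
      then obtain k where "k \<in> K" "x \<in> k" by blast
      with UN.IH[OF this(1)] show "\<exists>L\<in>?\<L>. \<exists>R\<in>?\<R>. x \<in> L \<inter> R \<and> L \<inter> R \<subseteq> \<Union>K"
        by (meson Sup_upper order_trans)
    qed
  next
    case (Basis s)
    then consider "s = A" | "s \<in> (\<lambda>a. {x \<in> A. (x, a) \<in> r}) ` A" | "s \<in> (\<lambda>a. {x \<in> A. (a, x) \<in> r}) ` A"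
      by blast
    then show ?case
    proof cases
      case 1
      show ?thesis by (rule ballI, rule bexI[of _ A], rule bexI[of _ A]) (use 1 in auto)
    next
      case 2
      show ?thesis by (rule ballI, rule bexI[of _ A], rule bexI[of _ s]) (use 2 in auto)
    next
      case 3
      show ?thesis by (rule ballI, rule bexI[of _ s], rule bexI[of _ A]) (use 3 in auto)
    qed
  qed simp
  then show thesis using x that by blast
qed

text \<open>A topological form of transfinite induction: for a given open cover, the points up to
  \<open>a\<close> whose segments have no finite subcover form a closed set, and a minimum of this
  set would have a finitely covered segment after all.\<close>

lemma compactin_initial_segment:
  assumes lin: "strict_linear_order_on A r"
    and min: "\<And>S. closedin (order_topology_on A r) S \<Longrightarrow> S \<noteq> {} \<Longrightarrow> \<exists>m\<in>S. \<forall>x\<in>S. (x, m) \<notin> r"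
    and a: "a \<in> A"
  shows "compactin (order_topology_on A r) (initial_segment A r a)"
  unfolding compactin_def topspace_order_topology_on
proof (intro conjI allI impI)
  let ?I = "initial_segment A r"
  have tr: "\<And>x y z. (x, y) \<in> r \<Longrightarrow> (y, z) \<in> r \<Longrightarrow> (x, z) \<in> r" and ir: "\<And>x. (x, x) \<notin> r"
    and tot: "\<And>x y. x \<in> A \<Longrightarrow> y \<in> A \<Longrightarrow> x \<noteq> y \<Longrightarrow> (x, y) \<in> r \<or> (y, x) \<in> r"
    using lin unfolding strict_linear_order_on_def trans_def irrefl_def total_on_def by blast+
  show "?I a \<subseteq> A" unfolding initial_segment_def by blast
  fix \<U> assume \<U>: "(\<forall>U\<in>\<U>. openin (order_topology_on A r) U) \<and> ?I a \<subseteq> \<Union>\<U>"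
  define fincov where "fincov S \<longleftrightarrow> (\<exists>\<F>. finite \<F> \<and> \<F> \<subseteq> \<U> \<and> S \<subseteq> \<Union>\<F>)" for S
  have fincov_mono: "fincov S" if "fincov T" "S \<subseteq> T" for S T
    using that unfolding fincov_def by blast
  have fincov_Un: "fincov (S \<union> U)" if S: "fincov S" and U: "U \<in> \<U>" for S U
  proof -
    obtain \<F> where "finite \<F>" "\<F> \<subseteq> \<U>" "S \<subseteq> \<Union>\<F>" using S unfolding fincov_def by blast
    then show ?thesis
      unfolding fincov_def by (intro exI[of _ "insert U \<F>"]) (use U in auto)
  qed
  have nbhd: "\<exists>U\<in>\<U>. \<exists>L R. L \<in> insert A ((\<lambda>a. {x \<in> A. (a, x) \<in> r}) ` A) \<and>
      R \<in> insert A ((\<lambda>a. {x \<in> A. (x, a) \<in> r}) ` A) \<and> x \<in> L \<inter> R \<and> L \<inter> R \<subseteq> U" if x: "x \<in> ?I a" for x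
  proof -
    obtain U where U: "U \<in> \<U>" "x \<in> U" using \<U> x by blast
    then have "openin (order_topology_on A r) U" using \<U> by blast
    from order_topology_on_interval_nbhd[OF lin this U(2)]
    obtain L R where "L \<in> insert A ((\<lambda>a. {x \<in> A. (a, x) \<in> r}) ` A)"
      "R \<in> insert A ((\<lambda>a. {x \<in> A. (x, a) \<in> r}) ` A)" "x \<in> L \<inter> R" "L \<inter> R \<subseteq> U" .
    with U(1) show ?thesis by (intro bexI exI conjI)
  qed
  have up: "I' \<in> A" if "I' \<in> ?I a" for I' using that unfolding initial_segment_def by blast
  define B where "B = {x \<in> ?I a. \<not> fincov (?I x)}"
  \<comment> \<open>Minima are available for closed sets only.\<close>
  have "closedin (order_topology_on A r) B"
  proof -
    have "openin (order_topology_on A r) (A - B)"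
    proof (subst openin_subopen, intro ballI)
      fix x assume x: "x \<in> A - B"
      show "\<exists>T. openin (order_topology_on A r) T \<and> x \<in> T \<and> T \<subseteq> A - B"
      proof (cases "x \<in> ?I a")
        case False
        then have "(a, x) \<in> r" using x a tot unfolding initial_segment_def by blast
        moreover have "{y \<in> A. (a, y) \<in> r} \<subseteq> A - B"
          unfolding B_def initial_segment_def using tr ir by blast
        ultimately show ?thesis using x openin_order_topology_on_greaterThan[OF a] by blast
      next
        case True
        then have cov: "fincov (?I x)" using x unfolding B_def by blast
        obtain U L R where ULR: "U \<in> \<U>" "L \<in> insert A ((\<lambda>a. {x \<in> A. (a, x) \<in> r}) ` A)"
          "R \<in> insert A ((\<lambda>a. {x \<in> A. (x, a) \<in> r}) ` A)" "x \<in> L \<inter> R" "L \<inter> R \<subseteq> U"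
          using nbhd[OF True] by blast
        have "openin (order_topology_on A r) A"
          using openin_topspace[of "order_topology_on A r"] unfolding topspace_order_topology_on .
        then have "openin (order_topology_on A r) L" "openin (order_topology_on A r) R"
          using ULR(2,3) by (auto simp: openin_order_topology_on_greaterThan openin_order_topology_on_lessThan)
        then have "openin (order_topology_on A r) (L \<inter> R)" by (rule openin_Int)
        moreover have "y \<notin> B" if y: "y \<in> L \<inter> R" for y
        proof -
          \<comment> \<open>\<open>L \<inter> R\<close> is convex, so the part of the segment of
            \<open>y\<close> above \<open>x\<close> lies in \<open>U\<close>.\<close>
          have "z \<in> L \<inter> R" if z: "z \<in> A" "(x, z) \<in> r" "(z, y) \<in> r \<or> z = y" for z
          proof
            show "z \<in> L" using ULR(2,4) z(1,2) tr[OF _ z(2)] by auto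
            show "z \<in> R" using ULR(3) y z tr[of z y] by auto
          qed
          then have "?I y \<subseteq> ?I x \<union> U"
            using ULR(5) tot x unfolding initial_segment_def by blast
          then show ?thesis
            using fincov_mono[OF fincov_Un[OF cov ULR(1)]] unfolding B_def by blast
        qed
        moreover have "L \<inter> R \<subseteq> A" using ULR(2) by blast
        ultimately show ?thesis using ULR(4) by blast
      qed
    qed
    moreover have "B \<subseteq> A" unfolding B_def initial_segment_def by blast
    ultimately show ?thesis unfolding closedin_def topspace_order_topology_on by blast
  qed
  have "B = {}"
  proof (rule ccontr)
    assume "B \<noteq> {}"
    then obtain m where m: "m \<in> B" "\<forall>x\<in>B. (x, m) \<notin> r"
      using min[OF \<open>closedin (order_topology_on A r) B\<close>] by blast
    then have mI: "m \<in> ?I a" unfolding B_def by blast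
    have mA: "m \<in> A" using up[OF mI] .
    obtain U L R where ULR: "U \<in> \<U>" "L \<in> insert A ((\<lambda>a. {x \<in> A. (a, x) \<in> r}) ` A)"
          "R \<in> insert A ((\<lambda>a. {x \<in> A. (x, a) \<in> r}) ` A)" "m \<in> L \<inter> R" "L \<inter> R \<subseteq> U"
      using nbhd[OF mI] by blast
    have below: "y \<in> R" if "y \<in> ?I m" for y
      using ULR(3,4) that tr[of y m] mA unfolding initial_segment_def by auto
    \<comment> \<open>Without a lower bound, \<open>U\<close> alone covers the segment of
      \<open>m\<close>. Otherwise the segment of the bound \<open>p\<close> is finitely covered by
      minimality of \<open>m\<close>, and \<open>U\<close> covers the rest.\<close>
    consider "L = A" | p where "p \<in> A" "L = {x \<in> A. (p, x) \<in> r}" using ULR(2) by blast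
    then have "fincov (?I m)"
    proof cases
      case 1
      then have "?I m \<subseteq> {} \<union> U" using below ULR(5) unfolding initial_segment_def by blast
      moreover have "fincov {}" unfolding fincov_def by blast
      ultimately show ?thesis using fincov_Un[OF _ ULR(1)] fincov_mono by blast
    next
      case 2
      have pm: "(p, m) \<in> r" using ULR(4) 2 by blast
      then have "p \<in> ?I a" using mI 2(1) tr unfolding initial_segment_def by blast
      then have "fincov (?I p)" using m(2) pm unfolding B_def by blast
      moreover have "?I m \<subseteq> ?I p \<union> U"
        using below ULR(5) 2 tot unfolding initial_segment_def by blast
      ultimately show ?thesis using fincov_Un[OF _ ULR(1)] fincov_mono by blast
    qed
    then show False using m(1) unfolding B_def by blast
  qed
  moreover have "a \<in> ?I a" using a unfolding initial_segment_def by blast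
  ultimately show "\<exists>\<F>. finite \<F> \<and> \<F> \<subseteq> \<U> \<and> ?I a \<subseteq> \<Union>\<F>"
    unfolding B_def fincov_def by blast
qed

text \<open>The minimum is continuous even on all non-empty closed sets: it lies below
  \<open>a\<close> iff the set hits the lower ray of \<open>a\<close>, and above \<open>a\<close>
  iff the set lies in the upper ray, whose complement is the compact initial segment of
  \<open>a\<close>.\<close>

lemma min_selection_continuous:
  assumes "topologically_well_orderable X"
  shows "\<exists>f. continuous_selection X (fell_topology X) (closed_hyperspace X) f"
proof -
  obtain r where r: "r \<subseteq> topspace X \<times> topspace X" and lin: "strict_linear_order_on (topspace X) r"
    and X: "X = order_topology_on (topspace X) r"
    and min: "\<And>S. closedin X S \<Longrightarrow> S \<noteq> {} \<Longrightarrow> \<exists>m\<in>S. \<forall>x\<in>S. (x, m) \<notin> r"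
    using assms unfolding topologically_well_orderable_def by metis
  define A where "A = topspace X"
  have XA: "X = order_topology_on A r" using X unfolding A_def .
  have tr: "\<And>x y z. (x, y) \<in> r \<Longrightarrow> (y, z) \<in> r \<Longrightarrow> (x, z) \<in> r" and ir: "\<And>x. (x, x) \<notin> r"
    and tot: "\<And>x y. x \<in> A \<Longrightarrow> y \<in> A \<Longrightarrow> x \<noteq> y \<Longrightarrow> (x, y) \<in> r \<or> (y, x) \<in> r"
    using lin unfolding A_def strict_linear_order_on_def trans_def irrefl_def total_on_def by blast+
  define f where "f S = (SOME m. m \<in> S \<and> (\<forall>x\<in>S. (x, m) \<notin> r))" for S
  have f: "f S \<in> S" "\<And>x. x \<in> S \<Longrightarrow> (x, f S) \<notin> r" "S \<subseteq> A" if "S \<in> closed_hyperspace X" for S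
  proof -
    have "\<exists>m. m \<in> S \<and> (\<forall>x\<in>S. (x, m) \<notin> r)"
      using min that unfolding closed_hyperspace_def by blast
    from someI_ex[OF this] show "f S \<in> S" "\<And>x. x \<in> S \<Longrightarrow> (x, f S) \<notin> r" unfolding f_def by blast+
    show "S \<subseteq> A" using that closedin_subset unfolding closed_hyperspace_def A_def by blast
  qed
  have op: "openin (fell_topology X) (hit_miss X \<V>)"
    if "finite \<V>" "\<forall>V\<in>\<V>. openin X V" "compactin X (topspace X - \<Union>\<V>)" for \<V>
    unfolding openin_fell_topology
    by (rule arbitrary_union_of_inc) (use that in \<open>auto simp: fell_base_def\<close>)
  have opA: "openin X A" unfolding A_def by simp
  have lessThan: "openin X {x \<in> A. (x, a) \<in> r}" and greaterThan: "openin X {x \<in> A. (a, x) \<in> r}" if "a \<in> A" for a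
    using that XA openin_order_topology_on_lessThan openin_order_topology_on_greaterThan by metis+
  have "continuous_map (fell_topology X) (order_topology_on A r) f"
    unfolding order_topology_on_def
  proof (rule continuous_on_generated_topo)
    fix U assume "U \<in> insert A ((\<lambda>a. {x \<in> A. (x, a) \<in> r}) ` A \<union> (\<lambda>a. {x \<in> A. (a, x) \<in> r}) ` A)"
    then consider "U = A" | a where "a \<in> A" "U = {x \<in> A. (x, a) \<in> r}"
      | a where "a \<in> A" "U = {x \<in> A. (a, x) \<in> r}" by blast
    then show "openin (fell_topology X) (f -` U \<inter> topspace (fell_topology X))"
    proof cases
      case 1
      have "f -` U \<inter> topspace (fell_topology X) = topspace (fell_topology X)"
        using f unfolding 1 topspace_fell_topology by blast
      then show ?thesis by simp
    next
      case 2
      \<comment> \<open>The member \<open>A\<close> makes the union the whole space, so that hitting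
        \<open>U\<close> is the only real condition.\<close>
      have eq: "f -` U \<inter> topspace (fell_topology X) = hit_miss X {A, U}"
      proof (intro set_eqI iffI)
        fix S assume "S \<in> f -` U \<inter> topspace (fell_topology X)"
        then show "S \<in> hit_miss X {A, U}"
          using f[of S] unfolding topspace_fell_topology hit_miss_def by auto
      next
        fix S assume "S \<in> hit_miss X {A, U}"
        then obtain x where x: "x \<in> S" "x \<in> U" and S: "S \<in> closed_hyperspace X"
          unfolding hit_miss_def by auto
        have "(f S, a) \<in> r" using f[OF S] x tot tr 2 by blast
        then show "S \<in> f -` U \<inter> topspace (fell_topology X)"
          using f[OF S] S 2 unfolding topspace_fell_topology by blast
      qed
      have "topspace X - \<Union>{A, U} = {}" unfolding A_def by blast
      then have "compactin X (topspace X - \<Union>{A, U})"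
        unfolding \<open>topspace X - \<Union>{A, U} = {}\<close> by simp
      then show ?thesis unfolding eq using op[of "{A, U}"] opA lessThan[OF 2(1)] 2(2) by auto
    next
      case 3
      have "f -` U \<inter> topspace (fell_topology X) = hit_miss X {U}"
      proof (intro set_eqI iffI)
        fix S assume "S \<in> f -` U \<inter> topspace (fell_topology X)"
        then have S: "S \<in> closed_hyperspace X" and fS: "f S \<in> U"
          unfolding topspace_fell_topology by auto
        have "S \<subseteq> U"
          using f[OF S] fS tot tr 3 by blast
        then show "S \<in> hit_miss X {U}"
          using f[OF S] S fS unfolding hit_miss_def by auto
      next
        fix S assume "S \<in> hit_miss X {U}"
        then show "S \<in> f -` U \<inter> topspace (fell_topology X)"
          using f[of S] unfolding topspace_fell_topology hit_miss_def by auto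
      qed
      moreover have "topspace X - \<Union>{U} = initial_segment A r a"
        using 3 tot tr ir unfolding initial_segment_def A_def by blast
      moreover have "compactin X (initial_segment A r a)"
        using compactin_initial_segment[OF lin[folded A_def] min[unfolded XA] 3(1)]
        unfolding XA[symmetric] by blast
      ultimately show ?thesis using op[of "{U}"] greaterThan 3 by simp
    qed
  next
    show "f ` topspace (fell_topology X) \<subseteq>
      \<Union> (insert A ((\<lambda>a. {x \<in> A. (x, a) \<in> r}) ` A \<union> (\<lambda>a. {x \<in> A. (a, x) \<in> r}) ` A))"
      using f(1,3) unfolding topspace_fell_topology by fast
  qed
  then have "continuous_map (fell_topology X) X f" using XA by simp
  then have "continuous_map (subtopology (fell_topology X) (closed_hyperspace X)) X f"
    by (rule continuous_map_from_subtopology)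
  then show ?thesis
    unfolding continuous_selection_def selection_on_def using f(1) by blast
qed

section \<open>Binary search trees over a tournament\<close>

text \<open>The points of \<open>A\<close> are inserted into a binary search tree in the order given by the
  well-order \<open>W\<close>; comparisons use the (in general intransitive) relation \<open>le\<close>. The set
  \<open>subtree w\<close> consists of the points whose search path passes through the node \<open>w\<close>, and
  \<open>tree_order\<close> compares two points at their lowest common node.\<close>

locale search_tree =
  fixes le :: "'a \<Rightarrow> 'a \<Rightarrow> bool" (infix \<open>\<preceq>\<close> 50)
    and W :: "'a rel"
    and A :: "'a set"
  assumes total: "x \<preceq> y \<or> y \<preceq> x"
    and antisym: "x \<preceq> y \<Longrightarrow> y \<preceq> x \<Longrightarrow> x = y"
    and wf_W: "wf W"
    and trans_W: "trans W"
    and total_W: "x \<noteq> y \<Longrightarrow> (x, y) \<in> W \<or> (y, x) \<in> W"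
begin

text \<open>By totality and antisymmetry a point is strictly below \<open>v\<close>, equal to
  \<open>v\<close> or strictly above it. The two equivalences say that both points fall into the
  same case, that is, leave \<open>v\<close> in the same direction.\<close>

definition same_side :: "'a \<Rightarrow> 'a \<Rightarrow> 'a \<Rightarrow> bool" where
  "same_side v y z \<longleftrightarrow> (y \<preceq> v \<longleftrightarrow> z \<preceq> v) \<and> (v \<preceq> y \<longleftrightarrow> v \<preceq> z)"

text \<open>The ancestors of \<open>w\<close> are the earlier \<open>v\<close> with
  \<open>w \<in> C v\<close>, so the tree, whose paths may be transfinite, is encoded by recursion
  along \<open>W\<close> on the node.\<close>

definition subtree :: "'a \<Rightarrow> 'a set" where
  "subtree = wfrec W (\<lambda>C w. {y. \<forall>v\<in>A. (v, w) \<in> W \<longrightarrow> w \<in> C v \<longrightarrow> same_side v y w})"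

text \<open>Two distinct points turn the same way at every common node before the lowest, so only
  the lowest can be the witness \<open>w\<close>; it may be \<open>y\<close> or \<open>z\<close>
  itself.\<close>

definition tree_order :: "'a rel" where
  "tree_order = {(y, z). y \<in> A \<and> z \<in> A \<and> y \<noteq> z \<and>
     (\<exists>w\<in>A. y \<in> subtree w \<and> z \<in> subtree w \<and> y \<preceq> w \<and> w \<preceq> z)}"

section \<open>Search paths and nesting of subtrees\<close>

lemma refl: "x \<preceq> x"
  using total by blast

lemma W_trans: "(x, y) \<in> W \<Longrightarrow> (y, z) \<in> W \<Longrightarrow> (x, z) \<in> W"
  using trans_W by (rule transD)

lemma mem_subtree:
  "y \<in> subtree w \<longleftrightarrow> (\<forall>v\<in>A. (v, w) \<in> W \<longrightarrow> w \<in> subtree v \<longrightarrow> same_side v y w)"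
proof -
  have "subtree w = {y. \<forall>v\<in>A. (v, w) \<in> W \<longrightarrow> w \<in> cut subtree W w v \<longrightarrow> same_side v y w}"
    using def_wfrec[OF eq_reflection[OF subtree_def] wf_W, of w] .
  then show ?thesis
    by (auto simp: cut_apply)
qed

lemma self_subtree: "w \<in> subtree w"
  unfolding mem_subtree[of w w] same_side_def by blast

lemma subtree_same_side:
  "y \<in> subtree w \<Longrightarrow> v \<in> A \<Longrightarrow> (v, w) \<in> W \<Longrightarrow> w \<in> subtree v \<Longrightarrow> same_side v y w"
  using mem_subtree by blast

text \<open>By induction, every node \<open>u\<close> on the path to \<open>v\<close> also lies on
  the path to \<open>w\<close>; there \<open>y\<close> turns as \<open>w\<close> does, and
  \<open>w\<close> as \<open>v\<close> does.\<close>

lemma subtree_trans: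
  assumes "y \<in> subtree w" "w \<in> subtree v" "(v, w) \<in> W"
  shows "y \<in> subtree v"
  using assms
proof (induction v arbitrary: y w rule: wf_induct_rule[OF wf_W])
  case (1 v)
  show ?case
    unfolding mem_subtree[of y v]
  proof (intro ballI impI)
    fix u assume u: "u \<in> A" "(u, v) \<in> W" "v \<in> subtree u"
    have "w \<in> subtree u" using 1(1)[OF u(2) 1(3) u(3) u(2)] .
    then have "same_side u y w"
      using subtree_same_side[OF 1(2) u(1) W_trans[OF u(2) 1(4)]] by blast
    moreover have "same_side u w v" using subtree_same_side[OF 1(3) u] .
    ultimately show "same_side u y v" unfolding same_side_def by blast
  qed
qed

text \<open>The nodes on the path of \<open>y\<close> form a chain: at each ancestor of
  \<open>w\<close>, the point \<open>y\<close> turns both as \<open>w\<close> and, by induction, as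
  \<open>w'\<close> does.\<close>

lemma subtree_nested:
  assumes "y \<in> subtree w" "y \<in> subtree w'" "(w, w') \<in> W"
  shows "w' \<in> subtree w"
  using assms
proof (induction w rule: wf_induct_rule[OF wf_W])
  case (1 w)
  show ?case
    unfolding mem_subtree[of w' w]
  proof (intro ballI impI)
    fix v assume v: "v \<in> A" "(v, w) \<in> W" "w \<in> subtree v"
    have vw': "(v, w') \<in> W" using W_trans[OF v(2) 1(4)] .
    have "y \<in> subtree v" using subtree_trans[OF 1(2) v(3,2)] .
    then have "w' \<in> subtree v" using 1(1)[OF v(2) _ 1(3) vw'] by blast
    then have "same_side v y w'" using subtree_same_side[OF 1(3) v(1) vw'] by blast
    moreover have "same_side v y w" using subtree_same_side[OF 1(2) v] .
    ultimately show "same_side v w' w" unfolding same_side_def by blast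
  qed
qed

text \<open>Nesting along the path of \<open>x\<close> puts \<open>u\<close> below \<open>w\<close>,
  so everything below \<open>u\<close> leaves \<open>w\<close> in the direction of \<open>u\<close>.
  This is the tool for comparing two nodes on one path.\<close>

lemma common_ancestor_same_side:
  assumes "y \<in> subtree u" "x \<in> subtree u" "x \<in> subtree w" "w \<in> A" "(w, u) \<in> W"
  shows "same_side w y u" "same_side w x u"
  using assms subtree_nested[OF assms(3,2,5)] subtree_same_side by blast+

section \<open>Separating nodes and linearity of the tree order\<close>

lemma W_irrefl: "(x, x) \<notin> W"
  using wf_W by simp

lemma same_side_strict:
  assumes "same_side v y z" "z \<noteq> v"
  shows "y \<noteq> v"
  using assms antisym refl unfolding same_side_def by blast

text \<open>Both \<open>u\<close> and \<open>w\<close> lie on the path of \<open>x\<close>, and at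
  the earlier of them \<open>x\<close> and the later one are on the same side. The conclusions are
  closed conditions, which \<open>closed_relation_separates\<close> refutes for \<open>y\<close>
  near \<open>y0\<close> when \<open>u\<close> ranges over a compact set.\<close>

lemma tree_order_separates_right:
  assumes w: "w \<in> A" "y0 \<in> subtree w" "x \<in> subtree w" "y0 \<preceq> w" "w \<preceq> x"
    and u: "u \<in> A" "x \<in> subtree u" "y \<in> subtree u" "x \<preceq> u" "u \<preceq> y"
  shows "w \<preceq> u" "y0 \<preceq> u \<or> w \<preceq> y"
proof -
  consider "u = w" | "(w, u) \<in> W" | "(u, w) \<in> W" using total_W by blast
  then have "w \<preceq> u \<and> (y0 \<preceq> u \<or> w \<preceq> y)"
  proof cases
    case 1
    then show ?thesis using w(4) refl by blast
  next
    case 2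
    then have "same_side w y u" "same_side w x u"
      using common_ancestor_same_side[OF u(3,2) w(3,1)] by blast+
    then show ?thesis using w(5) unfolding same_side_def by blast
  next
    case 3
    then have "same_side u y0 w" "same_side u x w"
      using common_ancestor_same_side[OF w(2,3) u(2,1)] by blast+
    then show ?thesis using u(4) unfolding same_side_def by blast
  qed
  then show "w \<preceq> u" "y0 \<preceq> u \<or> w \<preceq> y" by blast+
qed

text \<open>The mirror image, for nodes with \<open>u \<preceq> x\<close>.\<close>

lemma tree_order_separates_left:
  assumes w: "w \<in> A" "x \<in> subtree w" "y0 \<in> subtree w" "x \<preceq> w" "w \<preceq> y0"
    and u: "u \<in> A" "x \<in> subtree u" "y \<in> subtree u" "u \<preceq> x" "y \<preceq> u"
  shows "u \<preceq> w" "u \<preceq> y0 \<or> y \<preceq> w"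
proof -
  consider "u = w" | "(w, u) \<in> W" | "(u, w) \<in> W" using total_W by blast
  then have "u \<preceq> w \<and> (u \<preceq> y0 \<or> y \<preceq> w)"
  proof cases
    case 1
    then show ?thesis using w(5) refl by blast
  next
    case 2
    then have "same_side w y u" "same_side w x u"
      using common_ancestor_same_side[OF u(3,2) w(2,1)] by blast+
    then show ?thesis using w(4) unfolding same_side_def by blast
  next
    case 3
    then have "same_side u y0 w" "same_side u x w"
      using common_ancestor_same_side[OF w(3,2) u(2,1)] by blast+
    then show ?thesis using u(4) unfolding same_side_def by blast
  qed
  then show "u \<preceq> w" "u \<preceq> y0 \<or> y \<preceq> w" by blast+
qed

text \<open>The two separating nodes lie on the path of \<open>z\<close>. The earlier one also
  separates \<open>y\<close> from \<open>u\<close>, because the point compared at the later one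
  turns there as \<open>z\<close> does.\<close>

lemma tree_order_trans:
  assumes "(y, z) \<in> tree_order" "(z, u) \<in> tree_order"
  shows "(y, u) \<in> tree_order"
proof -
  obtain w where w: "w \<in> A" "y \<in> subtree w" "z \<in> subtree w" "y \<preceq> w" "w \<preceq> z"
    and yz: "y \<in> A" "y \<noteq> z" using assms(1) unfolding tree_order_def by blast
  obtain w' where w': "w' \<in> A" "z \<in> subtree w'" "u \<in> subtree w'" "z \<preceq> w'" "w' \<preceq> u"
    and zu: "u \<in> A" "z \<noteq> u" using assms(2) unfolding tree_order_def by blast
  consider "w' = w" | "(w, w') \<in> W" | "(w', w) \<in> W" using total_W by blast
  then show ?thesis
  proof cases
    case 1
    then have "z = w" using w(5) w'(4) antisym by blast
    then have "y \<noteq> u" using w(4) w'(5) 1 yz antisym by blast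
    then show ?thesis using 1 w w' yz(1) zu(1) unfolding tree_order_def by blast
  next
    case 2
    then have s: "same_side w u w'" "same_side w z w'"
      using common_ancestor_same_side[OF w'(3,2) w(3,1)] by blast+
    then have wu: "w \<preceq> u" using w(5) unfolding same_side_def by blast
    have "u \<noteq> w" using same_side_strict[OF s(1)] 2 W_irrefl by blast
    then have "y \<noteq> u" using wu w(4) antisym by blast
    moreover have "u \<in> subtree w"
      using subtree_trans[OF w'(3) subtree_nested[OF w(3) w'(2) 2] 2] .
    ultimately show ?thesis using wu w yz(1) zu(1) unfolding tree_order_def by blast
  next
    case 3
    then have s: "same_side w' y w" "same_side w' z w"
      using common_ancestor_same_side[OF w(2,3) w'(2,1)] by blast+
    then have yw: "y \<preceq> w'" using w'(4) unfolding same_side_def by blast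
    have "y \<noteq> w'" using same_side_strict[OF s(1)] 3 W_irrefl by blast
    then have "y \<noteq> u" using yw w'(5) antisym by blast
    moreover have "y \<in> subtree w'"
      using subtree_trans[OF w(2) subtree_nested[OF w'(2) w(3) 3] 3] .
    ultimately show ?thesis using yw w' yz(1) zu(1) unfolding tree_order_def by blast
  qed
qed

text \<open>If the search for \<open>z\<close> passes \<open>y\<close>, the node \<open>y\<close>
  decides. Otherwise the first node on the path of \<open>y\<close> at which \<open>z\<close> turns
  differently separates the two.\<close>

lemma tree_order_total:
  assumes "y \<in> A" "z \<in> A" "y \<noteq> z"
  shows "(y, z) \<in> tree_order \<or> (z, y) \<in> tree_order"
proof (cases "z \<in> subtree y")
  case True
  then show ?thesis
    using assms total[of y z] self_subtree[of y] refl[of y] unfolding tree_order_def by blast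
next
  case False
  define D where "D = {w \<in> A. (w, y) \<in> W \<and> y \<in> subtree w \<and> \<not> same_side w z y}"
  have "\<exists>w. w \<in> D" using False unfolding mem_subtree[of z y] D_def by blast
  then obtain w where w: "w \<in> D" and least: "\<And>v. (v, w) \<in> W \<Longrightarrow> v \<notin> D"
    using wfE_min[OF wf_W] by metis
  have wA: "w \<in> A" "(w, y) \<in> W" "y \<in> subtree w" "\<not> same_side w z y"
    using w unfolding D_def by blast+
  have "z \<in> subtree w"
    unfolding mem_subtree[of z w]
  proof (intro ballI impI)
    fix v assume v: "v \<in> A" "(v, w) \<in> W" "w \<in> subtree v"
    have "y \<in> subtree v" using subtree_trans[OF wA(3) v(3,2)] .
    then have "same_side v z y" using least[OF v(2)] v(1) W_trans[OF v(2) wA(2)] unfolding D_def by blast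
    moreover have "same_side v y w" using subtree_same_side[OF wA(3) v] .
    ultimately show "same_side v z w" unfolding same_side_def by blast
  qed
  moreover have "y \<preceq> w \<and> w \<preceq> z \<or> z \<preceq> w \<and> w \<preceq> y"
    using wA(4) total antisym unfolding same_side_def by metis
  ultimately show ?thesis using assms wA(1,3) unfolding tree_order_def by blast
qed

lemma tree_order_irrefl: "(y, y) \<notin> tree_order"
  unfolding tree_order_def by blast

lemma strict_linear_order_on_tree_order: "strict_linear_order_on A tree_order"
  unfolding strict_linear_order_on_def trans_def irrefl_def total_on_def
  using tree_order_trans tree_order_total tree_order_irrefl by blast

end

section \<open>Closed tournaments with compact lower sets\<close>

text \<open>The conditions imposed on \<open>u\<close> and \<open>y\<close> define a closed set of pairs, whose projection
  along the compact set \<open>M\<close> is closed; antisymmetry keeps \<open>y0\<close> out of this projection.\<close>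

lemma closed_relation_separates:
  assumes cl: "closedin (prod_topology X X) {p \<in> topspace X \<times> topspace X. le (fst p) (snd p)}"
    and "\<forall>x y. le x y \<longrightarrow> le y x \<longrightarrow> x = y"
    and M: "compactin X M"
    and y0: "y0 \<in> topspace X" and w: "w \<in> topspace X" and x: "x \<in> topspace X"
    and le: "le y0 w" "le w x" "y0 \<noteq> x"
  shows "\<exists>N. openin X N \<and> y0 \<in> N \<and>
    (\<forall>y\<in>N. \<forall>u\<in>M. le x u \<longrightarrow> le w u \<longrightarrow> le u y \<longrightarrow> \<not> (le y0 u \<or> le w y))"
proof -
  have antisym: "\<And>x y. le x y \<Longrightarrow> le y x \<Longrightarrow> x = y" using assms(2) by blast
  let ?P = "prod_topology X X"
  let ?R = "{p \<in> topspace X \<times> topspace X. le (fst p) (snd p)}"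
  have closed_pre: "closedin ?P {p \<in> topspace ?P. le (g p) (h p)}"
    if "continuous_map ?P X g" "continuous_map ?P X h" for g h
  proof -
    have "continuous_map ?P ?P (\<lambda>p. (g p, h p))"
      using that by (simp add: continuous_map_pairwise o_def)
    from closedin_continuous_map_preimage[OF this cl]
    have "closedin ?P {p \<in> topspace ?P. (g p, h p) \<in> ?R}" .
    moreover have "{p \<in> topspace ?P. (g p, h p) \<in> ?R} = {p \<in> topspace ?P. le (g p) (h p)}"
      using that[THEN continuous_map_image_subset_topspace] by auto
    ultimately show ?thesis by simp
  qed
  have const: "continuous_map ?P X (\<lambda>p. c)" if "c \<in> topspace X" for c
    using that by simp
  let ?S = "\<lambda>g h. {p \<in> topspace ?P. le (g p) (h p)}"
  \<comment> \<open>A point of the product stands for \<open>(u, y)\<close>; \<open>T\<close>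
    collects the configurations to be excluded near \<open>y0\<close>.\<close>
  define T where "T = ?S (\<lambda>p. x) fst \<inter> ?S (\<lambda>p. w) fst \<inter> ?S fst snd \<inter> (?S (\<lambda>p. y0) fst \<union> ?S (\<lambda>p. w) snd)"
  have "closedin ?P T"
    unfolding T_def
    by (intro closedin_Int closedin_Un closed_pre const continuous_map_fst continuous_map_snd x w y0)
  then have "closedin (prod_topology (subtopology X M) X) ((M \<times> topspace X) \<inter> T)"
    unfolding prod_topology_subtopology closedin_subtopology by blast
  moreover have "compact_space (subtopology X M)" using M by (simp add: compactin_subspace)
  ultimately have closed: "closedin X (snd ` ((M \<times> topspace X) \<inter> T))"
    using Abstract_Topological_Spaces.closed_map_snd unfolding closed_map_def by blast
  show ?thesis
  proof (intro exI conjI ballI impI notI)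
    show "openin X (topspace X - snd ` ((M \<times> topspace X) \<inter> T))" using closed by blast
    have "(u, y0) \<notin> T" for u
    proof
      assume "(u, y0) \<in> T"
      then have *: "le x u" "le w u" "le u y0" "le y0 u \<or> le w y0" unfolding T_def by auto
      \<comment> \<open>If \<open>y0 \<preceq> u\<close>, then \<open>u = y0\<close>, so both
        alternatives yield \<open>w \<preceq> y0\<close>. Afterwards all four points collapse,
        against \<open>y0 \<noteq> x\<close>.\<close>
      have "y0 = w" using * le(1) antisym by metis
      then have "u = w" using * antisym by blast
      then show False using * le antisym \<open>y0 = w\<close> by blast
    qed
    then show "y0 \<in> topspace X - snd ` ((M \<times> topspace X) \<inter> T)" using y0 by auto
  next
    fix y u assume y: "y \<in> topspace X - snd ` ((M \<times> topspace X) \<inter> T)" and u: "u \<in> M"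
      "le x u" "le w u" "le u y" "le y0 u \<or> le w y"
    have "u \<in> topspace X" using u(1) M compactin_subset_topspace by blast
    then have "(u, y) \<in> (M \<times> topspace X) \<inter> T" using y u unfolding T_def by auto
    then have "y \<in> snd ` ((M \<times> topspace X) \<inter> T)" by (metis imageI snd_conv)
    then show False using y by blast
  qed
qed

text \<open>This collects what the tree argument uses of a continuous selection. By
  \<open>locally_bounded\<close> the compact bounds on lower sets are uniform near each point, so
  the points below a compact set are again bounded. The well-order \<open>W\<close> has no relation
  to the topology.\<close>

locale compact_tournament = search_tree le W "topspace X"
  for X :: "'a topology" and le :: "'a \<Rightarrow> 'a \<Rightarrow> bool" (infix \<open>\<preceq>\<close> 50) and W +
  assumes Hausdorff: "Hausdorff_space X"
    and closed_le: "closedin (prod_topology X X) {p \<in> topspace X \<times> topspace X. fst p \<preceq> snd p}"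
    and compact_below: "x \<in> topspace X \<Longrightarrow> compactin X {z \<in> topspace X. z \<preceq> x}"
    and locally_bounded: "x \<in> topspace X \<Longrightarrow>
      \<exists>V M. openin X V \<and> x \<in> V \<and> compactin X M \<and> (\<forall>y\<in>V. {z \<in> topspace X. z \<preceq> y} \<subseteq> M)"
begin

text \<open>If some \<open>y\<close> near \<open>y0\<close> were not below \<open>x\<close>, a node
  \<open>u\<close> on the path of \<open>x\<close> would satisfy \<open>x \<preceq> u\<close> and
  \<open>u \<preceq> y\<close>. Such nodes range over a compact set, where
  \<open>closed_relation_separates\<close> excludes them.\<close>

lemma openin_less_tree_order:
  assumes x: "x \<in> topspace X"
  shows "openin X {y \<in> topspace X. (y, x) \<in> tree_order}"
proof (subst openin_subopen, intro ballI)
  fix y0 assume "y0 \<in> {y \<in> topspace X. (y, x) \<in> tree_order}"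
  then obtain w where y0: "y0 \<in> topspace X" "y0 \<noteq> x"
    and w: "w \<in> topspace X" "y0 \<in> subtree w" "x \<in> subtree w" "y0 \<preceq> w" "w \<preceq> x"
    unfolding tree_order_def by blast
  define R where "R = {u \<in> topspace X. x \<in> subtree u \<and> x \<preceq> u}"
  have "x \<in> R" using x self_subtree refl unfolding R_def by blast
  then obtain u0 where u0: "u0 \<in> R" "\<And>v. (v, u0) \<in> W \<Longrightarrow> v \<notin> R"
    using wfE_min[OF wf_W] by metis
  \<comment> \<open>The nodes at which the search for \<open>x\<close> turns left decrease along the path, so the first one
    bounds them all and places them in a compact set.\<close>
  have R: "u \<preceq> u0" if "u \<in> R" for u
  proof (cases "u = u0")
    case True
    then show ?thesis using refl by blast
  next
    case False
    then have "(u0, u) \<in> W" using u0(2) that total_W by blast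
    then have "same_side u0 x u"
      using common_ancestor_same_side(2)[of x u x u0] that u0(1) unfolding R_def by blast
    then show ?thesis using u0(1) unfolding R_def same_side_def by blast
  qed
  have cpt: "compactin X {z \<in> topspace X. z \<preceq> u0}"
    using compact_below u0(1) unfolding R_def by blast
  have "\<forall>a b. a \<preceq> b \<longrightarrow> b \<preceq> a \<longrightarrow> a = b" using antisym by blast
  from closed_relation_separates[OF closed_le this cpt y0(1) w(1) x w(4,5) y0(2)]
  obtain N where N: "openin X N" "y0 \<in> N"
    "\<forall>y\<in>N. \<forall>u\<in>{z \<in> topspace X. z \<preceq> u0}. x \<preceq> u \<longrightarrow> w \<preceq> u \<longrightarrow> u \<preceq> y \<longrightarrow> \<not> (y0 \<preceq> u \<or> w \<preceq> y)"
    by (elim exE conjE)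
  have "(y, x) \<in> tree_order" if y: "y \<in> N" for y
  proof (rule ccontr)
    assume "(y, x) \<notin> tree_order"
    moreover have yX: "y \<in> topspace X" using y N(1) openin_subset by blast
    ultimately have "y = x \<or> (x, y) \<in> tree_order" using tree_order_total x by blast
    \<comment> \<open>For \<open>y = x\<close> the node \<open>x\<close> itself serves as
      \<open>u\<close>.\<close>
    then obtain u where u: "u \<in> topspace X" "x \<in> subtree u" "y \<in> subtree u" "x \<preceq> u" "u \<preceq> y"
      using x self_subtree refl unfolding tree_order_def by blast
    have "u \<preceq> u0" using R u(1,2,4) unfolding R_def by blast
    then show False using N(3) y u(1,4,5) tree_order_separates_right[OF w u] by blast
  qed
  then have "N \<subseteq> {y \<in> topspace X. (y, x) \<in> tree_order}" using openin_subset[OF N(1)] by blast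
  then show "\<exists>T. openin X T \<and> y0 \<in> T \<and> T \<subseteq> {y \<in> topspace X. (y, x) \<in> tree_order}"
    using N(1,2) by blast
qed

lemma closed_ge: "closedin (prod_topology X X) {p \<in> topspace X \<times> topspace X. snd p \<preceq> fst p}"
proof -
  have "continuous_map (prod_topology X X) (prod_topology X X) (\<lambda>p. (snd p, fst p))"
    by (simp add: continuous_map_pairwise o_def continuous_map_fst continuous_map_snd)
  from closedin_continuous_map_preimage[OF this closed_le]
  show ?thesis by (rule back_subst[of "closedin _"]) auto
qed

text \<open>The same argument for the reversed relation. The nodes \<open>u\<close> now satisfy
  \<open>u \<preceq> x\<close>, so the lower set of \<open>x\<close> is the compact set that
  contains them.\<close>

lemma openin_greater_tree_order:
  assumes x: "x \<in> topspace X"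
  shows "openin X {y \<in> topspace X. (x, y) \<in> tree_order}"
proof (subst openin_subopen, intro ballI)
  fix y0 assume "y0 \<in> {y \<in> topspace X. (x, y) \<in> tree_order}"
  then obtain w where y0: "y0 \<in> topspace X" "y0 \<noteq> x"
    and w: "w \<in> topspace X" "x \<in> subtree w" "y0 \<in> subtree w" "x \<preceq> w" "w \<preceq> y0"
    unfolding tree_order_def by blast
  have "\<forall>a b. b \<preceq> a \<longrightarrow> a \<preceq> b \<longrightarrow> a = b" using antisym by blast
  from closed_relation_separates[of X "\<lambda>a b. b \<preceq> a", OF closed_ge this compact_below[OF x]
      y0(1) w(1) x w(5,4) y0(2)]
  obtain N where N: "openin X N" "y0 \<in> N"
    "\<forall>y\<in>N. \<forall>u\<in>{z \<in> topspace X. z \<preceq> x}. u \<preceq> x \<longrightarrow> u \<preceq> w \<longrightarrow> y \<preceq> u \<longrightarrow> \<not> (u \<preceq> y0 \<or> y \<preceq> w)"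
    by (elim exE conjE)
  have "(x, y) \<in> tree_order" if y: "y \<in> N" for y
  proof (rule ccontr)
    assume "(x, y) \<notin> tree_order"
    moreover have yX: "y \<in> topspace X" using y N(1) openin_subset by blast
    ultimately have "y = x \<or> (y, x) \<in> tree_order" using tree_order_total x by blast
    then obtain u where u: "u \<in> topspace X" "x \<in> subtree u" "y \<in> subtree u" "u \<preceq> x" "y \<preceq> u"
      using x self_subtree refl unfolding tree_order_def by blast
    then show False using N(3) y u(1,4,5) tree_order_separates_left[OF w u] by blast
  qed
  then have "N \<subseteq> {y \<in> topspace X. (x, y) \<in> tree_order}" using openin_subset[OF N(1)] by blast
  then show "\<exists>T. openin X T \<and> y0 \<in> T \<and> T \<subseteq> {y \<in> topspace X. (x, y) \<in> tree_order}"
    using N(1,2) by blast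
qed

section \<open>Compact initial segments, the order topology and minima\<close>

lemma below_compact_bounded:
  assumes "compactin X Q"
  obtains M where "compactin X M" "\<And>u z. u \<in> Q \<Longrightarrow> z \<in> topspace X \<Longrightarrow> z \<preceq> u \<Longrightarrow> z \<in> M"
proof -
  \<comment> \<open>By \<open>locally_bounded\<close> the sets with one compact bound for all their
    lower sets cover the space. Finitely many of them cover \<open>Q\<close>, and the union of their
    bounds is the required set.\<close>
  define \<V> where "\<V> = {V. openin X V \<and> (\<exists>M. compactin X M \<and> (\<forall>y\<in>V. {z \<in> topspace X. z \<preceq> y} \<subseteq> M))}"
  have "Q \<subseteq> \<Union>\<V>"
  proof
    fix u assume "u \<in> Q"
    then have "u \<in> topspace X" using assms compactin_subset_topspace by blast
    from locally_bounded[OF this] show "u \<in> \<Union>\<V>" unfolding \<V>_def by blast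
  qed
  then obtain \<F> where \<F>: "finite \<F>" "\<F> \<subseteq> \<V>" "Q \<subseteq> \<Union>\<F>"
    using compactinD[OF assms, of \<V>] unfolding \<V>_def by blast
  have "\<forall>V\<in>\<F>. \<exists>M. compactin X M \<and> (\<forall>y\<in>V. {z \<in> topspace X. z \<preceq> y} \<subseteq> M)"
    using \<F>(2) unfolding \<V>_def by blast
  then obtain m where m: "\<And>V. V \<in> \<F> \<Longrightarrow> compactin X (m V)"
    "\<And>V y. V \<in> \<F> \<Longrightarrow> y \<in> V \<Longrightarrow> {z \<in> topspace X. z \<preceq> y} \<subseteq> m V" by metis
  show thesis
  proof
    show "compactin X (\<Union>(m ` \<F>))" using \<F>(1) m(1) by (intro compactin_Union) auto
    fix u z assume "u \<in> Q" "z \<in> topspace X" "z \<preceq> u"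
    then show "z \<in> \<Union>(m ` \<F>)" using \<F>(3) m(2) by blast
  qed
qed

lemma initial_segment_eq:
  assumes "x \<in> topspace X"
  shows "initial_segment (topspace X) tree_order x = topspace X - {y \<in> topspace X. (x, y) \<in> tree_order}"
  using assms tree_order_total tree_order_trans tree_order_irrefl unfolding initial_segment_def by blast

text \<open>Through the separating node, a point of the segment is two steps of
  \<open>\<preceq>\<close> below \<open>x\<close>, which confines the segment to a compact set; it
  is closed as the complement of an open ray.\<close>

lemma compactin_initial_segment_tree_order:
  assumes x: "x \<in> topspace X"
  shows "compactin X (initial_segment (topspace X) tree_order x)"
proof -
  obtain M where M: "compactin X M"
    "\<And>u z. u \<in> {z \<in> topspace X. z \<preceq> x} \<Longrightarrow> z \<in> topspace X \<Longrightarrow> z \<preceq> u \<Longrightarrow> z \<in> M"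
    using below_compact_bounded[OF compact_below[OF x]] by blast
  have "initial_segment (topspace X) tree_order x \<subseteq> M"
    using M(2) x refl unfolding initial_segment_def tree_order_def by blast
  moreover have "closedin X (initial_segment (topspace X) tree_order x)"
    unfolding initial_segment_eq[OF x] using openin_greater_tree_order[OF x] by blast
  ultimately show ?thesis using closed_compactin[OF M(1)] by blast
qed

text \<open>Open rays make the order topology coarser than \<open>X\<close>. Conversely, compact
  sets of \<open>X\<close> remain compact in the order topology and are closed there because it is
  Hausdorff, and every point has an order neighbourhood inside a compact initial segment.\<close>

lemma order_topology_on_tree_order: "X = order_topology_on (topspace X) tree_order"
proof -
  let ?T = "order_topology_on (topspace X) tree_order"
  let ?I = "initial_segment (topspace X) tree_order"
  have id: "continuous_map X ?T id"
    unfolding order_topology_on_def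
    by (rule continuous_on_generated_topo)
      (auto simp: vimage_def Int_def conj_commute openin_less_tree_order openin_greater_tree_order)
  have sub: "openin X U" if "openin ?T U" for U
  proof -
    have "U \<subseteq> topspace X" using openin_subset[OF that] unfolding topspace_order_topology_on .
    then have "{x \<in> topspace X. id x \<in> U} = U" by auto
    then show ?thesis using openin_continuous_map_preimage[OF id that] by metis
  qed
  have "openin ?T U" if U: "openin X U" for U
  proof (subst openin_subopen, intro ballI)
    fix x assume xU: "x \<in> U"
    have x: "x \<in> topspace X" using xU U openin_subset by blast
    have cpt_closed: "closedin ?T K" if "compactin X K" for K
      using compactin_imp_closedin[OF Hausdorff_space_order_topology_on[OF strict_linear_order_on_tree_order]]
        image_compactin[OF that id] by simp
    \<comment> \<open>Any \<open>b\<close> above \<open>x\<close> will do; if \<open>x\<close> is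
      the largest point, its own segment is the whole space.\<close>
    obtain b where b: "b \<in> topspace X" and
      nb: "\<exists>R. openin ?T R \<and> x \<in> R \<and> R \<subseteq> ?I b"
    proof (cases "\<exists>b\<in>topspace X. (x, b) \<in> tree_order")
      case True
      then obtain b where b: "b \<in> topspace X" "(x, b) \<in> tree_order" by blast
      show thesis
        by (rule that[OF b(1)], rule exI[of _ "{y \<in> topspace X. (y, b) \<in> tree_order}"])
          (use b x openin_order_topology_on_lessThan in \<open>auto simp: initial_segment_def\<close>)
    next
      case False
      then have "?I x = topspace ?T" unfolding initial_segment_eq[OF x] topspace_order_topology_on by blast
      then show thesis using that[OF x] x unfolding topspace_order_topology_on
        by (metis openin_topspace order_refl topspace_order_topology_on)
    qed
    then obtain R where R: "openin ?T R" "x \<in> R" "R \<subseteq> ?I b" by blast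
    \<comment> \<open>Removing this compact set from \<open>R\<close> leaves an order neighbourhood
      of \<open>x\<close> inside \<open>U\<close>.\<close>
    have "compactin X (?I b \<inter> (topspace X - U))"
      using compact_Int_closedin[OF compactin_initial_segment_tree_order[OF b]] U by blast
    then have "openin ?T (R - ?I b \<inter> (topspace X - U))"
      using R(1) cpt_closed by (simp add: openin_diff)
    moreover have "R - ?I b \<inter> (topspace X - U) \<subseteq> U"
      using R(3) unfolding initial_segment_def by blast
    ultimately show "\<exists>T. openin ?T T \<and> x \<in> T \<and> T \<subseteq> U" using R(2) xU by blast
  qed
  then show ?thesis using sub topology_eq by blast
qed

text \<open>Without a minimum, the upper rays of the points of the compact set \<open>?K\<close>
  would cover it. The least endpoint of a finite subcover lies in none of the rays chosen.\<close>

lemma closedin_tree_order_min: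
  assumes S: "closedin X S" "S \<noteq> {}"
  shows "\<exists>m\<in>S. \<forall>x\<in>S. (x, m) \<notin> tree_order"
proof (rule ccontr)
  assume "\<not> ?thesis"
  then have no_min: "\<And>m. m \<in> S \<Longrightarrow> \<exists>x\<in>S. (x, m) \<in> tree_order" by blast
  have SX: "S \<subseteq> topspace X" using S(1) closedin_subset by blast
  obtain s where s: "s \<in> S" using S(2) by blast
  let ?I = "initial_segment (topspace X) tree_order"
  let ?ray = "\<lambda>t. {y \<in> topspace X. (t, y) \<in> tree_order}"
  let ?K = "?I s \<inter> S"
  have "compactin X ?K"
    using compact_Int_closedin[OF compactin_initial_segment_tree_order S(1)] s SX by blast
  moreover have "?K \<subseteq> \<Union>(?ray ` ?K)"
  proof
    fix m assume m: "m \<in> ?K"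
    then obtain t where t: "t \<in> S" "(t, m) \<in> tree_order" using no_min by blast
    then have "t \<in> ?K" using m tree_order_trans SX unfolding initial_segment_def by blast
    then show "m \<in> \<Union>(?ray ` ?K)" using t m SX by blast
  qed
  moreover have "\<forall>U\<in>?ray ` ?K. openin X U" using openin_greater_tree_order SX by blast
  ultimately obtain \<F> where "finite \<F>" "\<F> \<subseteq> ?ray ` ?K" "?K \<subseteq> \<Union>\<F>"
    unfolding compactin_def by meson
  then obtain F where F: "finite F" "F \<subseteq> ?K" "?K \<subseteq> \<Union>(?ray ` F)"
    by (metis (no_types, lifting) finite_subset_image)
  have "s \<in> ?K" using s SX unfolding initial_segment_def by blast
  then have "F \<noteq> {}" using F(3) by blast
  moreover have "\<exists>m\<in>F. \<forall>t\<in>F. (t, m) \<notin> tree_order" if ne: "F \<noteq> {}"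
  proof -
    have "acyclic tree_order"
      using strict_linear_order_on_tree_order tree_order_irrefl
      unfolding strict_linear_order_on_def acyclic_def by (metis trancl_id)
    then have "wf (tree_order \<inter> F \<times> F)"
      using F(1) by (intro finite_acyclic_wf) (auto intro: acyclic_subset)
    moreover obtain t where "t \<in> F" using ne by blast
    ultimately obtain m where "m \<in> F" "\<And>y. (y, m) \<in> tree_order \<inter> F \<times> F \<Longrightarrow> y \<notin> F"
      by (rule wfE_min) blast
    then show ?thesis by blast
  qed
  ultimately obtain m where m: "m \<in> F" "\<forall>t\<in>F. (t, m) \<notin> tree_order" by blast
  have "m \<in> \<Union>(?ray ` F)" using subsetD[OF F(3) subsetD[OF F(2) m(1)]] .
  then show False using m(2) by blast
qed

lemma topologically_well_orderable: "topologically_well_orderable X"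
  unfolding topologically_well_orderable_def
proof (intro exI conjI)
  show "tree_order \<subseteq> topspace X \<times> topspace X" unfolding tree_order_def by blast
  show "\<forall>S. closedin X S \<and> S \<noteq> {} \<longrightarrow> (\<exists>m\<in>S. \<forall>x\<in>S. (x, m) \<notin> tree_order)"
    using closedin_tree_order_min by blast
qed (rule strict_linear_order_on_tree_order order_topology_on_tree_order)+

end

section \<open>Fell-continuous weak selections\<close>

lemma fell_selection_nbhd:
  assumes sel: "continuous_selection X (fell_topology X) D f"
    and D: "D \<subseteq> closed_hyperspace X"
    and S: "S \<in> D" and U: "openin X U" "f S \<in> U"
  obtains \<V> where "finite \<V>" "\<And>V. V \<in> \<V> \<Longrightarrow> openin X V" "compactin X (topspace X - \<Union>\<V>)"
    "S \<in> hit_miss X \<V>" "\<And>T. T \<in> D \<Longrightarrow> T \<in> hit_miss X \<V> \<Longrightarrow> f T \<in> U"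
proof -
  have cont: "continuous_map (subtopology (fell_topology X) D) X f"
    using sel unfolding continuous_selection_def by blast
  have top: "topspace (subtopology (fell_topology X) D) = D"
    using D by (auto simp: topspace_fell_topology)
  have "openin (subtopology (fell_topology X) D) {T \<in> D. f T \<in> U}"
    using openin_continuous_map_preimage[OF cont U(1)] unfolding top .
  then obtain O' where O': "openin (fell_topology X) O'" "{T \<in> D. f T \<in> U} = O' \<inter> D"
    unfolding openin_subtopology by blast
  have "S \<in> O'" using O'(2) S U(2) by blast
  then obtain B where "B \<in> fell_base X" "S \<in> B" "B \<subseteq> O'"
    using O'(1) unfolding openin_fell_topology union_of_def by blast
  then obtain \<V> where \<V>: "finite \<V>" "\<forall>V\<in>\<V>. openin X V" "compactin X (topspace X - \<Union>\<V>)"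
    "S \<in> hit_miss X \<V>" "hit_miss X \<V> \<subseteq> O'"
    unfolding fell_base_def by blast
  have "f T \<in> U" if "T \<in> D" "T \<in> hit_miss X \<V>" for T
    using that \<V>(5) O'(2) by blast
  with that[OF \<V>(1) bspec[OF \<V>(2)] \<V>(3,4)] show thesis by blast
qed

locale fell_selection =
  fixes X :: "'a topology" and f :: "'a set \<Rightarrow> 'a"
  assumes Hausdorff: "Hausdorff_space X"
    and sel: "continuous_selection X (fell_topology X) (closed_hyperspace2 X) f"
begin

text \<open>Pairs that are not contained in the space are compared by an arbitrary choice, so that
  the relation is total on the whole type.\<close>

definition le :: "'a \<Rightarrow> 'a \<Rightarrow> bool" (infix \<open>\<preceq>\<close> 50) where
  "x \<preceq> y \<longleftrightarrow> (if x \<in> topspace X \<and> y \<in> topspace X then f {x, y} else (SOME z. z \<in> {x, y})) = x"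

lemma pair_closed_hyperspace2:
  assumes "x \<in> topspace X" "y \<in> topspace X"
  shows "{x, y} \<in> closed_hyperspace2 X"
proof -
  have "closedin X {x, y}"
    using assms closedin_Hausdorff_finite[OF Hausdorff] by simp
  moreover have "card {x, y} \<le> 2" by (simp add: card_insert_if)
  ultimately show ?thesis unfolding closed_hyperspace2_def closed_hyperspace_def by simp
qed

lemma f_pair: "x \<in> topspace X \<Longrightarrow> y \<in> topspace X \<Longrightarrow> f {x, y} \<in> {x, y}"
  using sel pair_closed_hyperspace2 unfolding continuous_selection_def selection_on_def by blast

lemma le_iff: "x \<in> topspace X \<Longrightarrow> y \<in> topspace X \<Longrightarrow> x \<preceq> y \<longleftrightarrow> f {x, y} = x"
  unfolding le_def by simp

lemma le_total: "x \<preceq> y \<or> y \<preceq> x"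
proof (cases "x \<in> topspace X \<and> y \<in> topspace X")
  case True
  then show ?thesis using f_pair[of x y] unfolding le_def by (auto simp: insert_commute)
next
  case False
  have "(SOME z. z \<in> {x, y}) \<in> {x, y}" by (rule someI[of _ x]) simp
  then show ?thesis using False unfolding le_def by (auto simp: insert_commute disj_commute)
qed

lemma le_antisym: "x \<preceq> y \<Longrightarrow> y \<preceq> x \<Longrightarrow> x = y"
  unfolding le_def insert_commute[of y x "{}"] conj_commute[of "y \<in> topspace X"] by simp

section \<open>Neighbourhoods of pairs and closedness of the relation\<close>

lemma pair_hit_miss:
  assumes "x \<in> topspace X" "y \<in> topspace X"
  shows "{x, y} \<in> hit_miss X \<V> \<longleftrightarrow> (\<forall>V\<in>\<V>. x \<in> V \<or> y \<in> V) \<and> x \<in> \<Union>\<V> \<and> y \<in> \<Union>\<V>"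
  using pair_closed_hyperspace2[OF assms] unfolding hit_miss_def closed_hyperspace2_def by auto

lemma pair_nbhd:
  assumes x: "x \<in> topspace X" and y: "y \<in> topspace X" and U: "openin X U" "f {x, y} \<in> U"
  obtains \<V> where "finite \<V>" "\<And>V. V \<in> \<V> \<Longrightarrow> openin X V" "compactin X (topspace X - \<Union>\<V>)"
    "\<forall>V\<in>\<V>. x \<in> V \<or> y \<in> V" "x \<in> \<Union>\<V>" "y \<in> \<Union>\<V>"
    "\<And>a b. a \<in> topspace X \<Longrightarrow> b \<in> topspace X \<Longrightarrow> \<forall>V\<in>\<V>. a \<in> V \<or> b \<in> V \<Longrightarrow>
      a \<in> \<Union>\<V> \<Longrightarrow> b \<in> \<Union>\<V> \<Longrightarrow> f {a, b} \<in> U"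
proof -
  have D: "closed_hyperspace2 X \<subseteq> closed_hyperspace X" unfolding closed_hyperspace2_def by blast
  obtain \<V> where \<V>: "finite \<V>" "\<And>V. V \<in> \<V> \<Longrightarrow> openin X V" "compactin X (topspace X - \<Union>\<V>)"
    "{x, y} \<in> hit_miss X \<V>"
    "\<And>T. T \<in> closed_hyperspace2 X \<Longrightarrow> T \<in> hit_miss X \<V> \<Longrightarrow> f T \<in> U"
    using fell_selection_nbhd[OF sel D pair_closed_hyperspace2[OF x y] U] by metis
  have xy: "\<forall>V\<in>\<V>. x \<in> V \<or> y \<in> V" "x \<in> \<Union>\<V>" "y \<in> \<Union>\<V>"
    using \<V>(4) unfolding pair_hit_miss[OF x y] by blast+
  show thesis
    by (rule that[OF \<V>(1,2,3) xy]) (use \<V>(5) pair_closed_hyperspace2 pair_hit_miss in auto)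
qed

text \<open>The selection takes \<open>a\<close> from \<open>{a, b}\<close>, so from nearby pairs it
  takes a point of \<open>U\<close>, while \<open>b'\<close> stays in the disjoint set
  \<open>U'\<close> and cannot be the selected point.\<close>

lemma not_le_nbhd:
  assumes a: "a \<in> topspace X" and b: "b \<in> topspace X" and ab: "\<not> b \<preceq> a"
  shows "\<exists>G H. openin X G \<and> openin X H \<and> a \<in> G \<and> b \<in> H \<and> (\<forall>a'\<in>G. \<forall>b'\<in>H. \<not> b' \<preceq> a')"
proof -
  have "a \<noteq> b" using ab le_total by blast
  have "a \<preceq> b" using ab le_total by blast
  then have fab: "f {a, b} = a" using le_iff a b by blast
  obtain U U' where U: "openin X U" "openin X U'" "a \<in> U" "b \<in> U'" "disjnt U U'"
    using Hausdorff a b \<open>a \<noteq> b\<close> unfolding Hausdorff_space_def by blast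
  have fU: "f {a, b} \<in> U" using fab U(3) by simp
  obtain \<V> where \<V>: "finite \<V>" "\<And>V. V \<in> \<V> \<Longrightarrow> openin X V"
    "\<forall>V\<in>\<V>. a \<in> V \<or> b \<in> V" "a \<in> \<Union>\<V>" "b \<in> \<Union>\<V>"
    "\<And>a' b'. a' \<in> topspace X \<Longrightarrow> b' \<in> topspace X \<Longrightarrow> \<forall>V\<in>\<V>. a' \<in> V \<or> b' \<in> V \<Longrightarrow>
      a' \<in> \<Union>\<V> \<Longrightarrow> b' \<in> \<Union>\<V> \<Longrightarrow> f {a', b'} \<in> U"
    by (rule pair_nbhd[OF a b U(1) fU]) blast
  \<comment> \<open>A pair with one point in \<open>G\<close> and one in \<open>H\<close> hits every
    member of \<open>\<V>\<close>, because each member contains \<open>a\<close> or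
    \<open>b\<close>.\<close>
  define G where "G = \<Inter>(insert U {V \<in> \<V>. a \<in> V})"
  define H where "H = \<Inter>(insert U' {V \<in> \<V>. b \<in> V})"
  have "openin X G" "openin X H"
    unfolding G_def H_def by (rule openin_Inter; use \<V>(1,2) U(1,2) in auto)+
  moreover have "a \<in> G" "b \<in> H" unfolding G_def H_def using U(3,4) by blast+
  moreover have "\<not> b' \<preceq> a'" if a': "a' \<in> G" and b': "b' \<in> H" for a' b'
  proof -
    have X: "a' \<in> topspace X" "b' \<in> topspace X"
      using a' b' \<open>openin X G\<close> \<open>openin X H\<close> openin_subset by blast+
    have "f {a', b'} \<in> U"
      using \<V>(6)[OF X] \<V>(3-5) a' b' unfolding G_def H_def by blast
    moreover have "b' \<notin> U" using b' U(5) unfolding H_def disjnt_iff by blast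
    ultimately have "f {b', a'} \<noteq> b'" by (metis insert_commute)
    then show ?thesis using le_iff X by blast
  qed
  ultimately show ?thesis by blast
qed

lemma closedin_le: "closedin (prod_topology X X) {p \<in> topspace X \<times> topspace X. fst p \<preceq> snd p}"
proof -
  have "openin (prod_topology X X)
    (topspace (prod_topology X X) - {p \<in> topspace X \<times> topspace X. fst p \<preceq> snd p})"
    unfolding openin_prod_topology_alt
  proof (intro allI impI)
    fix b a assume "(b, a) \<in> topspace (prod_topology X X) - {p \<in> topspace X \<times> topspace X. fst p \<preceq> snd p}"
    then have "a \<in> topspace X" "b \<in> topspace X" "\<not> b \<preceq> a" by auto
    from not_le_nbhd[OF this] obtain G H where GH: "openin X G" "openin X H" "a \<in> G" "b \<in> H"
      "\<forall>a'\<in>G. \<forall>b'\<in>H. \<not> b' \<preceq> a'" by blast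
    moreover have "H \<times> G \<subseteq> topspace (prod_topology X X) - {p \<in> topspace X \<times> topspace X. fst p \<preceq> snd p}"
      using GH(5) openin_subset[OF GH(1)] openin_subset[OF GH(2)] by auto
    ultimately show "\<exists>U V. openin X U \<and> openin X V \<and> b \<in> U \<and> a \<in> V \<and>
      U \<times> V \<subseteq> topspace (prod_topology X X) - {p \<in> topspace X \<times> topspace X. fst p \<preceq> snd p}"
      by blast
  qed
  then show ?thesis unfolding closedin_def by auto
qed

section \<open>Compactness and local boundedness of lower sets\<close>

lemma closedin_below:
  assumes x: "x \<in> topspace X"
  shows "closedin X {z \<in> topspace X. z \<preceq> x}"
proof -
  have "continuous_map X (prod_topology X X) (\<lambda>z. (z, x))"
    using x by (simp add: continuous_map_pairwise o_def)
  from closedin_continuous_map_preimage[OF this closedin_le]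
  show ?thesis using x by (rule_tac back_subst[of "closedin _"]) auto
qed

text \<open>A Fell neighbourhood of the singleton of \<open>x\<close> contains all pairs of a point near \<open>x\<close> and a
  point outside a compact set.\<close>

lemma below_nbhd_bounded:
  assumes x: "x \<in> topspace X" and U: "openin X U" "x \<in> U"
  obtains V K where "openin X V" "x \<in> V" "compactin X K"
    "\<And>y z. y \<in> V \<Longrightarrow> z \<in> topspace X \<Longrightarrow> z \<preceq> y \<Longrightarrow> z \<in> U \<union> K"
proof -
  have "f {x, x} \<in> U" using f_pair[OF x x] U(2) by auto
  then obtain \<V> where \<V>: "finite \<V>" "\<And>V. V \<in> \<V> \<Longrightarrow> openin X V" "compactin X (topspace X - \<Union>\<V>)"
    "\<forall>V\<in>\<V>. x \<in> V \<or> x \<in> V" "x \<in> \<Union>\<V>"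
    "\<And>a b. a \<in> topspace X \<Longrightarrow> b \<in> topspace X \<Longrightarrow> \<forall>V\<in>\<V>. a \<in> V \<or> b \<in> V \<Longrightarrow>
      a \<in> \<Union>\<V> \<Longrightarrow> b \<in> \<Union>\<V> \<Longrightarrow> f {a, b} \<in> U"
    by (rule pair_nbhd[OF x x U(1)]) blast
  \<comment> \<open>As \<open>G\<close> lies in every member of \<open>\<V>\<close>, a point of
    \<open>G\<close> already supplies all hits. The only condition left on \<open>z\<close> is
    \<open>z \<in> \<Union>\<V>\<close>, and for \<open>z \<preceq> y\<close> the selected point is
    \<open>z\<close>.\<close>
  define G where "G = \<Inter>(insert U \<V>)"
  have "openin X G" unfolding G_def by (rule openin_Inter) (use \<V>(1,2) U in auto)
  moreover have "x \<in> G" unfolding G_def using \<V>(4) U(2) by blast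
  ultimately have G: "openin X G" "x \<in> G" .
  show thesis
  proof (rule that[OF G \<V>(3)])
    fix y z assume y: "y \<in> G" and z: "z \<in> topspace X" "z \<preceq> y"
    show "z \<in> U \<union> (topspace X - \<Union>\<V>)"
    proof (cases "z \<in> \<Union>\<V>")
      case True
      have yX: "y \<in> topspace X" using y G(1) openin_subset by blast
      have "f {z, y} \<in> U"
        using \<V>(6)[OF z(1) yX] True \<V>(5) y unfolding G_def by blast
      then show ?thesis using z le_iff[OF z(1) yX] by simp
    qed (use z in blast)
  qed
qed

text \<open>A member \<open>U\<close> of the cover that contains \<open>x\<close> already contains
  all points below \<open>x\<close> outside a compact set \<open>K\<close>; finitely many members
  cover the part in \<open>K\<close>, which is compact because lower sets are closed.\<close>

lemma compactin_below:
  assumes x: "x \<in> topspace X"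
  shows "compactin X {z \<in> topspace X. z \<preceq> x}"
  unfolding compactin_def
proof (intro conjI allI impI)
  let ?L = "{z \<in> topspace X. z \<preceq> x}"
  fix \<U> assume \<U>: "(\<forall>U\<in>\<U>. openin X U) \<and> ?L \<subseteq> \<Union>\<U>"
  have "x \<in> ?L" using x le_total by blast
  then obtain U where U: "U \<in> \<U>" "x \<in> U" using \<U> by blast
  then have "openin X U" using \<U> by blast
  then obtain V K where K: "x \<in> V" "compactin X K"
    "\<And>y z. y \<in> V \<Longrightarrow> z \<in> topspace X \<Longrightarrow> z \<preceq> y \<Longrightarrow> z \<in> U \<union> K"
    by (rule below_nbhd_bounded[OF x _ U(2)]) blast
  have "compactin X (K \<inter> ?L)" using compact_Int_closedin[OF K(2) closedin_below[OF x]] .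
  then obtain \<F> where \<F>: "finite \<F>" "\<F> \<subseteq> \<U>" "K \<inter> ?L \<subseteq> \<Union>\<F>"
    using \<U> compactinD[of X "K \<inter> ?L" \<U>] by blast
  have "?L \<subseteq> \<Union>(insert U \<F>)" using K(1,3) \<F>(3) by blast
  then show "\<exists>\<F>. finite \<F> \<and> \<F> \<subseteq> \<U> \<and> ?L \<subseteq> \<Union>\<F>"
    using \<F>(1,2) U(1) by (intro exI[of _ "insert U \<F>"]) auto
qed blast

text \<open>If some \<open>b\<close> is not below \<open>x\<close>, a neighbourhood \<open>U\<close>
  of \<open>x\<close> lies in the compact lower set of \<open>b\<close>, and points below those near
  \<open>x\<close> lie in \<open>U\<close> or in a compact \<open>K\<close>. Otherwise the lower set
  of \<open>x\<close> is the whole space, which is then compact.\<close>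

lemma below_locally_bounded:
  assumes x: "x \<in> topspace X"
  shows "\<exists>V M. openin X V \<and> x \<in> V \<and> compactin X M \<and> (\<forall>y\<in>V. {z \<in> topspace X. z \<preceq> y} \<subseteq> M)"
proof (cases "\<exists>b\<in>topspace X. \<not> b \<preceq> x")
  case True
  then obtain b where b: "b \<in> topspace X" "\<not> b \<preceq> x" by blast
  obtain U H where U: "openin X U" "x \<in> U" "b \<in> H" "\<forall>a'\<in>U. \<forall>b'\<in>H. \<not> b' \<preceq> a'"
    using not_le_nbhd[OF x b] by blast
  have Ub: "U \<subseteq> {z \<in> topspace X. z \<preceq> b}"
    using U(3,4) le_total openin_subset[OF U(1)] by blast
  obtain V K where V: "openin X V" "x \<in> V" "compactin X K"
    "\<And>y z. y \<in> V \<Longrightarrow> z \<in> topspace X \<Longrightarrow> z \<preceq> y \<Longrightarrow> z \<in> U \<union> K"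
    by (rule below_nbhd_bounded[OF x U(1,2)]) blast
  show ?thesis
  proof (intro exI conjI ballI)
    show "compactin X ({z \<in> topspace X. z \<preceq> b} \<union> K)"
      using compactin_Un[OF compactin_below[OF b(1)] V(3)] .
  next
    fix y assume "y \<in> V"
    then show "{z \<in> topspace X. z \<preceq> y} \<subseteq> {z \<in> topspace X. z \<preceq> b} \<union> K" using V(4) Ub by blast
  qed (use V in auto)
next
  case False
  then have "{z \<in> topspace X. z \<preceq> x} = topspace X" by blast
  then have "compactin X (topspace X)" using compactin_below[OF x] by simp
  then show ?thesis using x by (intro exI[of _ "topspace X"]) auto
qed

lemma topologically_well_orderable: "topologically_well_orderable X"
proof -
  \<comment> \<open>An arbitrary well-order of the type fixes the order of insertion; its strict
    part \<open>W - Id\<close> is the well-founded relation of the search tree.\<close>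
  obtain W :: "'a rel" where W: "well_order_on UNIV W" using well_order_on by blast
  then have "strict_linear_order_on UNIV (W - Id)" and wf: "wf (W - Id)"
    unfolding well_order_on_def using strict_linear_order_on_diff_Id by blast+
  then have tr: "trans (W - Id)" and tot: "total_on UNIV (W - Id)"
    unfolding strict_linear_order_on_def by blast+
  interpret compact_tournament X le "W - Id"
  proof
    show "(x, y) \<in> W - Id \<or> (y, x) \<in> W - Id" if "x \<noteq> y" for x y
      using tot that unfolding total_on_def by blast
  qed (fact le_total le_antisym wf tr Hausdorff closedin_le compactin_below below_locally_bounded)+
  show ?thesis by (rule topologically_well_orderable)
qed

end

theorem theorem1p2:
  fixes X :: "'a topology"
  assumes "Hausdorff_space X"
  shows "topologically_well_orderable X \<longleftrightarrow>
    (\<exists>f. continuous_selection X (fell_topology X) (closed_hyperspace2 X) f)"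
proof
  assume "topologically_well_orderable X"
  then obtain f where f: "continuous_selection X (fell_topology X) (closed_hyperspace X) f"
    using min_selection_continuous by blast
  have "closed_hyperspace2 X \<subseteq> closed_hyperspace X" unfolding closed_hyperspace2_def by blast
  then have "continuous_selection X (fell_topology X) (closed_hyperspace2 X) f"
    using f continuous_map_from_subtopology_mono
    unfolding continuous_selection_def selection_on_def by blast
  then show "\<exists>f. continuous_selection X (fell_topology X) (closed_hyperspace2 X) f" by blast
next
  assume "\<exists>f. continuous_selection X (fell_topology X) (closed_hyperspace2 X) f"
  then obtain f where "continuous_selection X (fell_topology X) (closed_hyperspace2 X) f" ..
  then interpret fell_selection X f
    using assms by unfold_locales
  show "topologically_well_orderable X" by (rule topologically_well_orderable)
qed

end
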